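(* Given three point vortices of equal (nonzero) weight with initial positions satisfying $0\le\theta^1_0<\theta^2_0<\theta^3_0<\pi/2$, the dynamics of the gaps $z^1=\theta^2-\theta^1$ and $z^2=\theta^3-\theta^2$ is always periodic in time, and it is stationary only when $z^1=z^2=\pi/6$. Consequently, generically the evolution of the triple $\{\theta^1,\theta^2,\theta^3\}$ undergoes a quasi-periodic motion.
   Context: The 1D point vortex system (modulo 4-fold rotational symmetry, i.e. describing positions in the circle $\mathbb{R}/\frac{\pi}{2}\mathbb{Z}$) for $N$ vortices with weights $a_1,\dots,a_N\in\mathbb{R}$ is the ODE system $$\frac{d}{dt}\theta^j(t)=\frac2\pi\sum_{l=1}^Na_l\sin\left(|2\theta^l(t)-2\theta^j(t)|\right),\qquad\theta^j(0)=\theta^j_0,\quad j=1,\dots,N.$$ Here $N=3$ and $a_1=a_2=a_3$. For initial data $\theta_0^1<\dots<\theta_0^N$ with $\theta_0^N-\theta_0^1<\pi/2$ (positions lifted to $\mathbb{R}$) the ordering and the inequality $\theta^N-\theta^1<\pi/2$ are preserved in time. *)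

theory Defs
  imports "HOL-Analysis.Analysis" "HOL-Library.Periodic_Fun"
begin

definition vortex_velocity :: "real ^ 'n \<Rightarrow> real ^ 'n \<Rightarrow> real ^ 'n" where
  "vortex_velocity a x =
     (\<chi> j. 2 / pi * (\<Sum>l\<in>UNIV. a $ l * sin \<bar>2 * x $ l - 2 * x $ j\<bar>))"

(* Positions are lifted from the circle R/(pi/2)Z to the real line.  The right-hand side is bounded
   and globally Lipschitz, so solutions are global in time. *)
definition vortex_solution :: "real ^ 'n \<Rightarrow> real ^ 'n \<Rightarrow> (real \<Rightarrow> real ^ 'n) \<Rightarrow> bool" where
  "vortex_solution a \<theta>\<^sub>0 \<theta> \<longleftrightarrow>
     \<theta> 0 = \<theta>\<^sub>0 \<and> (\<forall>t. (\<theta> has_vector_derivative vortex_velocity a (\<theta> t)) (at t))"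

definition initial_positions :: "(real ^ 3) set" where
  "initial_positions = {x. 0 \<le> x $ 1 \<and> x $ 1 < x $ 2 \<and> x $ 2 < x $ 3 \<and> x $ 3 < pi / 2}"

definition gaps :: "real ^ 3 \<Rightarrow> real \<times> real" where
  "gaps x = (x $ 2 - x $ 1, x $ 3 - x $ 2)"

(* The map s |-> cis (4 * s) identifies R/(pi/2)Z with the unit circle of the complex plane. *)
definition circle_positions :: "real ^ 'n \<Rightarrow> complex ^ 'n" where
  "circle_positions x = (\<chi> j. cis (4 * x $ j))"

definition rationally_independent :: "nat \<Rightarrow> (nat \<Rightarrow> real) \<Rightarrow> bool" where
  "rationally_independent k \<omega> \<longleftrightarrow>
     (\<forall>m :: nat \<Rightarrow> int. (\<Sum>i<k. of_int (m i) * \<omega> i) = 0 \<longrightarrow> (\<forall>i<k. m i = 0))"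

definition torus :: "nat \<Rightarrow> (nat \<Rightarrow> complex) set" where
  "torus k = ({..<k} \<rightarrow>\<^sub>E sphere 0 1)"

(* A continuous function on a k-dimensional torus, evaluated along a linear flow with rationally
   independent frequencies.  The number k of basic frequencies is arbitrary; k = 1 is the
   continuous periodic case. *)
definition quasi_periodic :: "(real \<Rightarrow> 'a::topological_space) \<Rightarrow> bool" where
  "quasi_periodic f \<longleftrightarrow>
     (\<exists>k \<omega> F. 1 \<le> k \<and> rationally_independent k \<omega> \<and> continuous_on (torus k) F \<and>
        (\<forall>t. f t = F (\<lambda>i\<in>{..<k}. cis (\<omega> i * t))))"

(* Genericity in both the topological and the measure-theoretic sense, relative to D. *)
definition generically :: "'a::euclidean_space set \<Rightarrow> ('a \<Rightarrow> bool) \<Rightarrow> bool" where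
  "generically D P \<longleftrightarrow>
     (\<exists>U. openin (top_of_set D) U \<and> D \<subseteq> closure U \<and> negligible (D - U) \<and> (\<forall>x\<in>U. P x))"

end

theory Submission imports Defs
begin

text \<open>
  Write \<open>p\<close>, \<open>q\<close> for the gaps and \<open>r = \<pi>/2 - p - q\<close>. The gaps satisfy \<open>p' = c sin p sin (q - r)\<close>,
  \<open>q' = c sin q sin (r - p)\<close>, which conserves \<open>P = sin p sin q sin r\<close>; since \<open>P\<close> vanishes on the
  boundary of the triangle \<open>p, q, r > 0\<close>, the gaps stay inside. As \<open>cot\<close> is decreasing, \<open>P\<close> strictly
  decreases along rays from \<open>(\<pi>/6, \<pi>/6)\<close>, and \<open>c\<close> times its radial derivative is the angular momentum
  of the gaps about that point. Compactness of the level set bounds the angular velocity away from 0,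
  so after a full turn the gaps return to the same ray, hence to the same point.
  By uniqueness of solutions, \<open>\<theta> (t + T) = \<theta> t + (d, d, d)\<close> for all \<open>t\<close>: on the circle the motion is a
  periodic motion composed with a uniform rotation.
\<close>

section \<open>Uniqueness for Lipschitz differential equations\<close>

text \<open>The bound on \<open>u'\<close> makes \<open>u t * exp (- K * t)\<close> nonincreasing
  and \<open>u t * exp (K * t)\<close> nondecreasing. Starting from 0, the first rules out positive
  values in the future, the second in the past.\<close>

lemma gronwall_zero:
  fixes u :: "real \<Rightarrow> real"
  assumes deriv: "\<And>t. (u has_real_derivative u' t) (at t)"
    and bound: "\<And>t. \<bar>u' t\<bar> \<le> K * u t"
    and "\<And>t. 0 \<le> u t" and "u 0 = 0"
  shows "u t = 0"
proof -
  have "u t \<le> 0"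
  proof (cases "0 \<le> t")
    case True
    have "u t * exp (- K * t) \<le> u 0 * exp (- K * 0)"
    proof (rule DERIV_nonpos_imp_nonincreasing[OF True])
      fix s
      have "((\<lambda>s. u s * exp (- K * s)) has_real_derivative (u' s - K * u s) * exp (- K * s)) (at s)"
        by (auto intro!: derivative_eq_intros deriv simp: algebra_simps)
      moreover have "(u' s - K * u s) * exp (- K * s) \<le> 0"
        using bound[of s] by (simp add: mult_le_0_iff)
      ultimately show "\<exists>y. ((\<lambda>s. u s * exp (- K * s)) has_real_derivative y) (at s) \<and> y \<le> 0"
        by blast
    qed
    then show ?thesis using assms(4) by (simp add: mult_le_0_iff)
  next
    case False
    then have "t \<le> 0" by simp
    have "u t * exp (K * t) \<le> u 0 * exp (K * 0)"
    proof (rule DERIV_nonneg_imp_nondecreasing[OF \<open>t \<le> 0\<close>])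
      fix s
      have "((\<lambda>s. u s * exp (K * s)) has_real_derivative (u' s + K * u s) * exp (K * s)) (at s)"
        by (auto intro!: derivative_eq_intros deriv simp: algebra_simps)
      moreover have "0 \<le> (u' s + K * u s) * exp (K * s)"
        using bound[of s] by simp
      ultimately show "\<exists>y. ((\<lambda>s. u s * exp (K * s)) has_real_derivative y) (at s) \<and> 0 \<le> y"
        by blast
    qed
    then show ?thesis using assms(4) by (simp add: mult_le_0_iff)
  qed
  with assms(3)[of t] show ?thesis by simp
qed

text \<open>By Cauchy-Schwarz the squared distance of the two solutions changes at a rate of at most
  \<open>2 * L\<close> times itself, so Gronwall applies.\<close>

lemma lipschitz_ode_unique:
  fixes x y :: "real \<Rightarrow> 'a::real_inner"
  assumes lip: "\<And>u v. norm (F u - F v) \<le> L * norm (u - v)"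
    and x: "\<And>t. (x has_vector_derivative F (x t)) (at t)"
    and y: "\<And>t. (y has_vector_derivative F (y t)) (at t)"
    and "x 0 = y 0"
  shows "x t = y t"
proof -
  define u where "u = (\<lambda>t. (x t - y t) \<bullet> (x t - y t))"
  have deriv: "(u has_real_derivative 2 * ((x t - y t) \<bullet> (F (x t) - F (y t)))) (at t)" for t
  proof -
    have "((\<lambda>t. x t - y t) has_vector_derivative F (x t) - F (y t)) (at t)"
      by (intro has_vector_derivative_diff x y)
    then have "((\<lambda>t. x t - y t) has_derivative (\<lambda>h. h *\<^sub>R (F (x t) - F (y t)))) (at t)"
      by (simp add: has_vector_derivative_def)
    from has_derivative_inner[OF this this] show ?thesis
      by (simp add: u_def has_field_derivative_def inner_commute algebra_simps)
         (erule has_derivative_eq_rhs, simp add: fun_eq_iff algebra_simps inner_commute)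
  qed
  have bound: "\<bar>2 * ((x t - y t) \<bullet> (F (x t) - F (y t)))\<bar> \<le> (2 * L) * u t" for t
  proof -
    have "\<bar>(x t - y t) \<bullet> (F (x t) - F (y t))\<bar> \<le> norm (x t - y t) * norm (F (x t) - F (y t))"
      by (rule Cauchy_Schwarz_ineq2)
    also have "\<dots> \<le> norm (x t - y t) * (L * norm (x t - y t))"
      by (intro mult_left_mono lip) simp
    also have "\<dots> = L * u t"
      by (simp add: u_def dot_square_norm power2_eq_square)
    finally show ?thesis by simp
  qed
  have "u t = 0"
    by (rule gronwall_zero[OF deriv bound]) (auto simp: u_def \<open>x 0 = y 0\<close>)
  then show ?thesis by (simp add: u_def)
qed

section \<open>Curves turning around the origin\<close>

text \<open>Lifting to the logarithm: \<open>w t = w 0 * exp (g t)\<close> with \<open>g' = w' / w\<close>.\<close>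

lemma curve_full_turn:
  fixes w w' :: "real \<Rightarrow> complex"
  assumes deriv: "\<And>t. (w has_vector_derivative w' t) (at t)"
    and cont: "continuous_on UNIV w'"
    and nz: "\<And>t. w t \<noteq> 0"
    and "\<epsilon> > 0" and \<sigma>: "\<sigma> = 1 \<or> \<sigma> = -1"
    and turn: "\<And>t. \<epsilon> \<le> \<sigma> * Im (w' t / w t)"
  obtains T r where "T > 0" "r > 0" "w T = of_real r * w 0"
proof -
  \<comment> \<open>An angle growing at rate at least \<open>\<epsilon>\<close> completes a full
    turn by time \<open>S\<close>.\<close>
  define S where "S = 2 * pi / \<epsilon>"
  have "S > 0" using \<open>\<epsilon> > 0\<close> by (simp add: S_def)
  have contw: "continuous_on UNIV w"
    by (meson continuous_at_imp_continuous_on deriv has_vector_derivative_continuous)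
  have "continuous_on {0..S} (\<lambda>t. w' t / w t)"
    by (intro continuous_intros continuous_on_subset[OF cont] continuous_on_subset[OF contw])
       (auto simp: nz)
  then obtain g0 where g0: "\<And>t. t \<in> {0..S} \<Longrightarrow>
      (g0 has_vector_derivative w' t / w t) (at t within {0..S})"
    using antiderivative_continuous by blast
  define g where "g = (\<lambda>t. g0 t - g0 0)"
  have g: "(g has_vector_derivative w' t / w t) (at t within {0..S})" if "t \<in> {0..S}" for t
    unfolding g_def using has_vector_derivative_diff[OF g0[OF that] has_vector_derivative_const]
    by simp
  \<comment> \<open>With \<open>g' = w' / w\<close> the two terms of the product rule
    cancel.\<close>
  have "\<exists>k. \<forall>t\<in>{0..S}. w t * exp (- g t) = k"
  proof (rule has_vector_derivative_zero_constant)
    fix t assume t: "t \<in> {0..S}"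
    have "((\<lambda>t. exp (- g t)) has_vector_derivative - (w' t / w t) * exp (- g t))
        (at t within {0..S})"
      using field_vector_diff_chain_within[OF has_vector_derivative_minus[OF g[OF t]]
          has_field_derivative_at_within[OF DERIV_exp]]
      by (simp add: o_def)
    from has_vector_derivative_mult[OF has_vector_derivative_at_within[OF deriv] this]
    show "((\<lambda>t. w t * exp (- g t)) has_vector_derivative 0) (at t within {0..S})"
      by (rule has_vector_derivative_eq_rhs) (simp add: nz)
  qed auto
  then have "w t * exp (- g t) = w 0" if "t \<in> {0..S}" for t
    using that \<open>S > 0\<close> by (force simp: g_def)
  then have w_exp: "w t = w 0 * exp (g t)" if "t \<in> {0..S}" for t
    using that by (metis exp_minus_inverse mult.assoc mult.commute mult.right_neutral)
  \<comment> \<open>The continuously lifted angle swept since time 0, oriented by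
    \<open>\<sigma>\<close> so that it increases.\<close>
  define y where "y = (\<lambda>t. \<sigma> * Im (g t))"
  have y': "(y has_real_derivative \<sigma> * Im (w' t / w t)) (at t within {0..S})"
    if "t \<in> {0..S}" for t
    unfolding y_def has_real_derivative_iff_has_vector_derivative
    by (intro has_vector_derivative_mult_right
        bounded_linear.has_vector_derivative[OF bounded_linear_Im] g that)
  have conty: "continuous_on {0..S} y"
    using y' by (rule DERIV_continuous_on)
  have "y 0 - \<epsilon> * 0 \<le> y S - \<epsilon> * S"
  proof (rule DERIV_nonneg_imp_increasing_open[of 0 S "\<lambda>t. y t - \<epsilon> * t"])
    fix t assume t: "0 < t" "t < S"
    then have "(y has_real_derivative \<sigma> * Im (w' t / w t)) (at t)"
      using y'[of t] by (simp add: at_within_Icc_at)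
    then have "((\<lambda>t. y t - \<epsilon> * t) has_real_derivative \<sigma> * Im (w' t / w t) - \<epsilon>) (at t)"
      by (auto intro!: derivative_eq_intros)
    with turn[of t] show "\<exists>d. ((\<lambda>t. y t - \<epsilon> * t) has_real_derivative d) (at t) \<and> 0 \<le> d"
      by (intro exI conjI) auto
  qed (use \<open>S > 0\<close> in \<open>auto intro!: continuous_intros conty\<close>)
  then have "y 0 \<le> 2 * pi" "2 * pi \<le> y S"
    using \<open>\<epsilon> > 0\<close> by (auto simp: y_def g_def S_def)
  then obtain T where T: "0 \<le> T" "T \<le> S" "y T = 2 * pi"
    using IVT'[of y 0 "2 * pi" S] conty \<open>S > 0\<close> by auto
  have "T \<noteq> 0" using T(3) by (auto simp: y_def g_def)
  have "cis (Im (g T)) = 1"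
  proof -
    have "Im (g T) = 2 * pi \<or> Im (g T) = - (2 * pi)"
      using T(3) \<sigma> by (auto simp: y_def)
    then show ?thesis
      by (metis cis_2pi cis_inverse inverse_1)
  qed
  then have "w T = of_real (exp (Re (g T))) * w 0"
    using w_exp[of T] T by (simp add: exp_eq_polar)
  then show thesis
    using that[of T "exp (Re (g T))"] T \<open>T \<noteq> 0\<close> by simp
qed

section \<open>Quasi-periodicity\<close>

text \<open>The circle is the quotient of the line by the period. \<open>G\<close> is constant on
  the fibres of \<open>e\<close>, and compactness of one period makes the induced map
  continuous.\<close>

lemma continuous_periodic_factors_through_circle:
  fixes G :: "real \<Rightarrow> 'a::topological_space"
  assumes cont: "continuous_on UNIV G" and "T > 0" and per: "\<And>t. G (t + T) = G t"
  obtains h where "continuous_on (sphere 0 1) h" "\<And>t. G t = h (cis (2 * pi / T * t))"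
proof -
  define e where "e = (\<lambda>t. cis (2 * pi / T * t))"
  have e_cont: "continuous_on A e" for A
    unfolding e_def by (intro continuous_intros)
  interpret periodic_fun_simple G T by standard (rule per)
  have cong: "G s = G t" if "e s = e t" for s t
  proof -
    have "cis (2 * pi / T * s - 2 * pi / T * t) = 1"
      using that by (simp add: e_def cis_divide[symmetric])
    then have "cos (2 * pi / T * s - 2 * pi / T * t) = 1"
      by (simp add: complex_eq_iff)
    then obtain n :: int where "2 * pi / T * s - 2 * pi / T * t = of_int n * (2 * pi)"
      by (auto simp: cos_one_2pi_int)
    then have "pi * s = pi * (t + of_int n * T)"
      using \<open>T > 0\<close> by (simp add: field_simps)
    then have "s = t + of_int n * T" by simp
    then show ?thesis by (simp add: plus_of_int)
  qed
  have surj: "\<exists>t\<in>{0..T}. e t = z" if z: "z \<in> sphere 0 1" for z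
  proof -
    have "norm z = 1" using z by simp
    then obtain \<phi> where "0 \<le> \<phi>" "\<phi> < 2 * pi" "z = cis \<phi>"
      by (metis Arg2pi Arg2pi_lt_2pi Arg2pi_ge_0 Arg2pi_eq cis_conv_exp mult_1 of_real_1)
    then show ?thesis
      using \<open>T > 0\<close> by (intro bexI[of _ "T * \<phi> / (2 * pi)"]) (auto simp: e_def field_simps)
  qed
  \<comment> \<open>By \<open>cong\<close> the chosen preimage does not affect the value.\<close>
  define h where "h = (\<lambda>z. G (SOME t. e t = z))"
  have G_h: "G t = h (e t)" for t
    unfolding h_def by (rule cong) (metis (mono_tags, lifting) someI)
  have "continuous_on (sphere 0 1) h"
  proof (subst continuous_on_closed_invariant, intro allI impI)
    fix C :: "'a set" assume "closed C"
    \<comment> \<open>On the circle, the preimage of \<open>C\<close> under \<open>h\<close> is the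
      image of a compact subset of one period, hence closed.\<close>
    define A where "A = e ` ({0..T} \<inter> G -` C)"
    have "closed (G -` C \<inter> UNIV)"
      using cont \<open>closed C\<close> by (subst (asm) continuous_on_closed_vimage) auto
    then have "compact ({0..T} \<inter> G -` C)"
      by (intro compact_Int_closed) auto
    then have "closed A"
      unfolding A_def by (intro compact_imp_closed compact_continuous_image e_cont)
    moreover have "A \<inter> sphere 0 1 = h -` C \<inter> sphere 0 1"
      using surj by (fastforce simp: A_def G_h)
    ultimately show "\<exists>A. closed A \<and> A \<inter> sphere 0 1 = h -` C \<inter> sphere 0 1"
      by blast
  qed
  with G_h show thesis
    using that by (simp add: e_def)
qed

lemma continuous_on_torus_coordinate:
  assumes "continuous_on (sphere 0 1) h" and "i < k"
  shows "continuous_on (torus k) (\<lambda>x. h (x i))"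
  using assms
  by (intro continuous_on_compose2[OF assms(1) continuous_on_subset
        [OF continuous_on_product_coordinates]]) (auto simp: torus_def)

lemma quasi_periodic_if_periodic:
  fixes f :: "real \<Rightarrow> 'a::topological_space"
  assumes "continuous_on UNIV f" and "T > 0" and "\<And>t. f (t + T) = f t"
  shows "quasi_periodic f"
proof -
  obtain h where h: "continuous_on (sphere 0 1) h" "\<And>t. f t = h (cis (2 * pi / T * t))"
    using continuous_periodic_factors_through_circle assms by blast
  have "rationally_independent 1 (\<lambda>_. 2 * pi / T)"
    using \<open>T > 0\<close> by (simp add: rationally_independent_def)
  moreover have "continuous_on (torus 1) (\<lambda>x. h (x 0))"
    by (rule continuous_on_torus_coordinate[OF h(1)]) simp
  ultimately show ?thesis
    unfolding quasi_periodic_def using h(2)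
    by (intro exI[of _ "1::nat"] exI[of _ "\<lambda>_. 2 * pi / T"] exI[of _ "\<lambda>x. h (x 0)"]) auto
qed

text \<open>If the rotation rate is commensurable with the period, the motion is periodic; otherwise it is
  a linear flow on the 2-torus.\<close>

lemma quasi_periodic_if_periodic_up_to_rotation:
  fixes f :: "real \<Rightarrow> complex ^ 'n"
  assumes cont: "continuous_on UNIV f" and "T > 0"
    and rot: "\<And>t j. f (t + T) $ j = cis \<alpha> * f t $ j"
  shows "quasi_periodic f"
proof -
  define \<omega> where "\<omega> = (\<lambda>i::nat. if i = 0 then 2 * pi / T else \<alpha> / T)"
  \<comment> \<open>\<open>f\<close> seen in a frame rotating at the constant rate
    \<open>\<alpha> / T\<close>, in which the rotation by \<open>\<alpha>\<close> per time
    \<open>T\<close> disappears.\<close>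
  define G where "G = (\<lambda>t. \<chi> j. cis (- (\<alpha> / T * t)) * f t $ j)"
  have G_cont: "continuous_on UNIV G"
    unfolding G_def using cont by (intro continuous_intros)
  have G_per: "G (t + T) = G t" for t
  proof -
    have "cis (- (\<alpha> / T * (t + T))) * cis \<alpha> = cis (- (\<alpha> / T * t))"
      using \<open>T > 0\<close> by (simp add: cis_mult field_simps)
    then show ?thesis
      by (simp add: G_def vec_eq_iff rot mult.assoc[symmetric])
  qed
  have f_G: "f t $ j = cis (\<alpha> / T * t) * G t $ j" for t j
    by (simp add: G_def mult.assoc[symmetric] cis_mult)
  show ?thesis
  proof (cases "rationally_independent 2 \<omega>")
    case True
    obtain h where h: "continuous_on (sphere 0 1) h" "\<And>t. G t = h (cis (2 * pi / T * t))"
      using continuous_periodic_factors_through_circle[OF G_cont \<open>T > 0\<close> G_per] by blast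
    \<comment> \<open>Coordinate 0 carries the phase of the periodic part, coordinate 1 the uniform
      rotation.\<close>
    define F where "F = (\<lambda>x :: nat \<Rightarrow> complex. \<chi> j. x 1 * h (x 0) $ j)"
    have "continuous_on (torus 2) (\<lambda>x. h (x 0))" "continuous_on (torus 2) (\<lambda>x. x 1)"
      using continuous_on_torus_coordinate[OF h(1), of 0 2]
        continuous_on_torus_coordinate[OF continuous_on_id, of 1 2] by auto
    then have "continuous_on (torus 2) F"
      unfolding F_def by (intro continuous_intros)
    moreover have "f t = F (\<lambda>i\<in>{..<2}. cis (\<omega> i * t))" for t
      using f_G by (simp add: F_def vec_eq_iff \<omega>_def h(2))
    ultimately show ?thesis
      unfolding quasi_periodic_def using True by (intro exI[of _ "2::nat"]) auto
  next
    case False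
    then obtain m :: "nat \<Rightarrow> int" where m: "of_int (m 0) * (2 * pi / T) + of_int (m 1) * (\<alpha> / T) = 0"
      and nz: "m 0 \<noteq> 0 \<or> m 1 \<noteq> 0"
      by (auto simp: rationally_independent_def \<omega>_def numeral_2_eq_2 less_Suc_eq)
    \<comment> \<open>The integer relation makes \<open>\<alpha>\<close> a rational multiple of a
      full turn, so after \<open>\<bar>m 1\<bar>\<close> returns the accumulated rotation is
      trivial.\<close>
    have *: "of_int (m 1) * \<alpha> = - of_int (m 0) * (2 * pi)"
      using m \<open>T > 0\<close> by (simp add: field_simps)
    then have "m 1 \<noteq> 0" using nz by auto
    have pow: "f (t + of_nat n * T) $ j = cis (of_nat n * \<alpha>) * f t $ j" for n t j
    proof (induction n)
      case (Suc n)
      have "f (t + of_nat (Suc n) * T) $ j = cis \<alpha> * f (t + of_nat n * T) $ j"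
        using rot[of "t + of_nat n * T"] by (simp add: algebra_simps)
      also have "\<dots> = (cis \<alpha> * cis (of_nat n * \<alpha>)) * f t $ j"
        by (simp add: Suc)
      also have "cis \<alpha> * cis (of_nat n * \<alpha>) = cis (of_nat (Suc n) * \<alpha>)"
        by (simp add: cis_mult algebra_simps)
      finally show ?case .
    qed simp
    define n where "n = nat \<bar>m 1\<bar>"
    have n: "of_nat n = \<bar>of_int (m 1) :: real\<bar>" by (simp add: n_def)
    have "cis (of_nat n * \<alpha>) = 1"
    proof -
      have "of_nat n * \<alpha> = 2 * pi * of_int (if m 1 > 0 then - m 0 else m 0)"
        using * unfolding n by (auto simp: abs_if)
      then show ?thesis by (metis cis_multiple_2pi Ints_of_int)
    qed
    then have "f (t + of_nat n * T) = f t" for t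
      by (simp add: vec_eq_iff pow)
    moreover have "of_nat n * T > 0"
      using \<open>m 1 \<noteq> 0\<close> \<open>T > 0\<close> by (simp add: n)
    ultimately show ?thesis
      using quasi_periodic_if_periodic[OF cont] by blast
  qed
qed

section \<open>The product of sines on the triangle of gaps\<close>

text \<open>The open simplex of arc lengths: the third arc closing the circle of length
  \<open>pi / 2\<close> is \<open>pi / 2 - p - q\<close>.\<close>

definition gap_triangle :: "(real \<times> real) set" where
  "gap_triangle = {(p, q). 0 < p \<and> 0 < q \<and> p + q < pi / 2}"

definition sine_product :: "real \<Rightarrow> real \<Rightarrow> real" where
  "sine_product p q = sin p * sin q * sin (pi / 2 - p - q)"

text \<open>The directional derivative of \<open>sine_product\<close> at \<open>(p, q)\<close> along
  \<open>(u, v)\<close>; the third arc changes at rate \<open>- (u + v)\<close>.\<close>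

definition sine_product_deriv :: "real \<Rightarrow> real \<Rightarrow> real \<Rightarrow> real \<Rightarrow> real" where
  "sine_product_deriv p q u v =
     u * (cos p * sin q * sin (pi / 2 - p - q)) + v * (sin p * cos q * sin (pi / 2 - p - q))
       - (u + v) * (sin p * sin q * cos (pi / 2 - p - q))"

lemma sine_product_has_derivative:
  assumes "(f has_real_derivative f') (at t)" and "(g has_real_derivative g') (at t)"
  shows "((\<lambda>t. sine_product (f t) (g t)) has_real_derivative
    sine_product_deriv (f t) (g t) f' g') (at t)"
  unfolding sine_product_def sine_product_deriv_def
  by (auto intro!: derivative_eq_intros assms simp: algebra_simps)

lemma sine_product_pos:
  assumes "(p, q) \<in> gap_triangle"
  shows "sine_product p q > 0"
  using assms unfolding sine_product_def gap_triangle_def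
  by (auto intro!: mult_pos_pos sin_gt_zero)

lemma in_gap_triangle_if_sine_product_pos:
  assumes "0 \<le> p" "0 \<le> q" "p + q \<le> pi / 2" "sine_product p q > 0"
  shows "(p, q) \<in> gap_triangle"
proof -
  have "p \<noteq> 0" "q \<noteq> 0" "pi / 2 - p - q \<noteq> 0"
    using assms(4) by (auto simp: sine_product_def)
  with assms(1-3) show ?thesis by (auto simp: gap_triangle_def)
qed

text \<open>This compares the cotangents at \<open>p\<close> and \<open>m\<close>, weighted by
  \<open>p - m\<close> and freed of division by \<open>sin p\<close>. After multiplication by
  \<open>sin m\<close> the difference of the two sides is
  \<open>(p - m) * sin (p - m)\<close>.\<close>

lemma cos_times_diff_le:
  fixes p m :: real
  assumes "\<bar>p - m\<bar> < pi" and "sin m > 0"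
  shows "(p - m) * cos p \<le> cos m / sin m * ((p - m) * sin p)"
    and "p \<noteq> m \<Longrightarrow> (p - m) * cos p < cos m / sin m * ((p - m) * sin p)"
proof -
  have eq: "sin m * (cos m / sin m * ((p - m) * sin p) - (p - m) * cos p) = (p - m) * sin (p - m)"
    using assms(2) by (simp add: sin_diff algebra_simps)
  have pos: "(p - m) * sin (p - m) > 0" if "p \<noteq> m"
  proof (cases "p > m")
    case True
    then show ?thesis using assms(1) by (intro mult_pos_pos sin_gt_zero) auto
  next
    case False
    then have "sin (m - p) > 0" using that assms(1) by (intro sin_gt_zero) auto
    then have "sin (p - m) < 0" using sin_minus[of "m - p"] by simp
    then show ?thesis using False that by (intro mult_neg_neg) auto
  qed
  show "(p - m) * cos p < cos m / sin m * ((p - m) * sin p)" if "p \<noteq> m"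
    using pos[OF that] assms(2) unfolding eq[symmetric] by (simp add: zero_less_mult_iff)
  then show "(p - m) * cos p \<le> cos m / sin m * ((p - m) * sin p)"
    by (cases "p = m") auto
qed

text \<open>After division by the product of sines this says that \<open>cot\<close> is decreasing.\<close>

lemma sine_product_radial_deriv_neg:
  assumes tri: "(p, q) \<in> gap_triangle" and ne: "(p, q) \<noteq> (pi / 6, pi / 6)"
  shows "sine_product_deriv p q (p - pi / 6) (q - pi / 6) < 0"
proof -
  define m where "m = pi / 6"
  define r where "r = pi / 2 - p - q"
  define \<kappa> where "\<kappa> = cos m / sin m"
  have bounds: "0 < p" "0 < q" "0 < r" "p < pi" "q < pi" "r < pi"
    using tri by (auto simp: gap_triangle_def r_def)
  have sins: "0 < sin p" "0 < sin q" "0 < sin r" "0 < sin m"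
    using bounds by (auto intro!: sin_gt_zero simp: m_def)
  have m: "0 < m" "m < pi" "p + q + r = 3 * m" by (auto simp: m_def r_def)
  note le = cos_times_diff_le[OF _ sins(4), folded \<kappa>_def]
  have le_p: "((p - m) * cos p) * (sin q * sin r) \<le> (\<kappa> * ((p - m) * sin p)) * (sin q * sin r)"
    using bounds sins m by (intro mult_right_mono le) auto
  have le_q: "((q - m) * cos q) * (sin p * sin r) \<le> (\<kappa> * ((q - m) * sin q)) * (sin p * sin r)"
    using bounds sins m by (intro mult_right_mono le) auto
  have le_r: "((r - m) * cos r) * (sin p * sin q) \<le> (\<kappa> * ((r - m) * sin r)) * (sin p * sin q)"
    using bounds sins m by (intro mult_right_mono le) auto
  have lt_p: "((p - m) * cos p) * (sin q * sin r) < (\<kappa> * ((p - m) * sin p)) * (sin q * sin r)"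
    if "p \<noteq> m" using that bounds sins m by (intro mult_strict_right_mono le) auto
  have lt_q: "((q - m) * cos q) * (sin p * sin r) < (\<kappa> * ((q - m) * sin q)) * (sin p * sin r)"
    if "q \<noteq> m" using that bounds sins m by (intro mult_strict_right_mono le) auto
  have "r - m = - (p - m) - (q - m)" using m(3) by simp
  \<comment> \<open>Each summand is \<open>\<kappa> * sin p * sin q * sin r\<close> times a
    deviation from \<open>m\<close>, and the three deviations add up to 0.\<close>
  then have zero: "(\<kappa> * ((p - m) * sin p)) * (sin q * sin r) + (\<kappa> * ((q - m) * sin q)) * (sin p * sin r)
      + (\<kappa> * ((r - m) * sin r)) * (sin p * sin q) = 0"
    by (simp only:) (simp add: algebra_simps)
  have eq: "sine_product_deriv p q (p - m) (q - m) = ((p - m) * cos p) * (sin q * sin r)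
      + ((q - m) * cos q) * (sin p * sin r) + ((r - m) * cos r) * (sin p * sin q)"
    unfolding sine_product_deriv_def r_def[symmetric] \<open>r - m = - (p - m) - (q - m)\<close>
    by (simp add: algebra_simps)
  from ne have "p \<noteq> m \<or> q \<noteq> m" by (auto simp: m_def)
  then have "sine_product_deriv p q (p - m) (q - m) < 0"
    using le_p le_q le_r lt_p lt_q zero unfolding eq by linarith
  then show ?thesis by (simp add: m_def)
qed

text \<open>The triangle is convex and contains the centre, so the ray stays inside up to
  \<open>R\<close>, where the radial derivative is negative away from the centre.\<close>

lemma sine_product_decreasing_on_rays:
  assumes "0 \<le> r" "r < R" "(u, v) \<noteq> (0, 0)"
    and tri: "(pi / 6 + R * u, pi / 6 + R * v) \<in> gap_triangle"
  shows "sine_product (pi / 6 + R * u) (pi / 6 + R * v) < sine_product (pi / 6 + r * u) (pi / 6 + r * v)"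
proof (rule DERIV_neg_imp_decreasing_open[OF \<open>r < R\<close>])
  fix x assume x: "r < x" "x < R"
  define p q where "p = pi / 6 + x * u" and "q = pi / 6 + x * v"
  have "x > 0" using x assms by simp
  \<comment> \<open>An affine function positive at 0 and at \<open>R\<close> is positive in between.
    It serves each of the three arcs, the third with slope \<open>- u - v\<close>.\<close>
  have segment: "m + x * w > 0" if "m > 0" "m + R * w > 0" for m w :: real
  proof (cases "w \<ge> 0")
    case True
    then show ?thesis using \<open>x > 0\<close> that by (simp add: add_pos_nonneg)
  next
    case False
    then have "R * w \<le> x * w" using x by (intro mult_right_mono_neg) auto
    then show ?thesis using that by simp
  qed
  have "(p, q) \<in> gap_triangle"
    using tri segment[of "pi / 6" u] segment[of "pi / 6" v] segment[of "pi / 6" "- u - v"]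
    by (auto simp: gap_triangle_def p_def q_def algebra_simps)
  moreover have "(p, q) \<noteq> (pi / 6, pi / 6)"
    using assms(3) \<open>x > 0\<close> by (auto simp: p_def q_def)
  ultimately have "sine_product_deriv p q (p - pi / 6) (q - pi / 6) < 0"
    by (rule sine_product_radial_deriv_neg)
  \<comment> \<open>The offset from the centre is \<open>x\<close> times \<open>(u, v)\<close>, and
    the derivative is linear in the direction.\<close>
  also have "sine_product_deriv p q (p - pi / 6) (q - pi / 6) = x * sine_product_deriv p q u v"
    by (simp add: sine_product_deriv_def p_def q_def algebra_simps)
  finally have "sine_product_deriv p q u v < 0"
    using \<open>x > 0\<close> by (simp add: mult_less_0_iff)
  moreover have "((\<lambda>x. sine_product (pi / 6 + x * u) (pi / 6 + x * v)) has_real_derivative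
      sine_product_deriv p q u v) (at x)"
    unfolding p_def q_def
    by (rule sine_product_has_derivative) (auto intro!: derivative_eq_intros)
  ultimately show "\<exists>y. ((\<lambda>x. sine_product (pi / 6 + x * u) (pi / 6 + x * v)) has_real_derivative y)
      (at x) \<and> y < 0"
    by blast
qed (auto simp: sine_product_def intro!: continuous_intros)

lemma sine_product_less_max:
  assumes "(p, q) \<in> gap_triangle" and "(p, q) \<noteq> (pi / 6, pi / 6)"
  shows "sine_product p q < sine_product (pi / 6) (pi / 6)"
  using sine_product_decreasing_on_rays[of 0 1 "p - pi / 6" "q - pi / 6"] assms by simp

text \<open>Strict decrease along the ray excludes both \<open>r < 1\<close> and
  \<open>r > 1\<close>. This turns a return to the same ray into a return to the same point.\<close>

lemma sine_product_level_meets_ray_once: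
  assumes "r > 0" "(u, v) \<noteq> (0, 0)"
    and "(pi / 6 + u, pi / 6 + v) \<in> gap_triangle"
    and "(pi / 6 + r * u, pi / 6 + r * v) \<in> gap_triangle"
    and "sine_product (pi / 6 + r * u) (pi / 6 + r * v) = sine_product (pi / 6 + u) (pi / 6 + v)"
  shows "r = 1"
  using sine_product_decreasing_on_rays[of 1 r u v] sine_product_decreasing_on_rays[of r 1 u v] assms
  by (cases r "1::real" rule: linorder_cases) auto

text \<open>The quotient below is the angular velocity of the gaps around the equilibrium, up to a
  constant factor.\<close>

lemma angular_velocity_bound:
  assumes tri: "(p0, q0) \<in> gap_triangle" and ne: "(p0, q0) \<noteq> (pi / 6, pi / 6)"
  obtains \<delta> where "\<delta> > 0" and "\<And>p q. (p, q) \<in> gap_triangle \<Longrightarrow> sine_product p q = sine_product p0 q0 \<Longrightarrow>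
    sine_product_deriv p q (p - pi / 6) (q - pi / 6) / ((p - pi / 6)\<^sup>2 + (q - pi / 6)\<^sup>2) \<le> - \<delta>"
proof -
  \<comment> \<open>Weak inequalities make \<open>K\<close> compact. The positive level keeps it off
    the boundary of the triangle, and a level below the maximum keeps it off the centre, where the
    quotient is singular.\<close>
  define K where "K = {x :: real \<times> real. 0 \<le> fst x \<and> 0 \<le> snd x \<and> fst x + snd x \<le> pi / 2 \<and>
    sine_product (fst x) (snd x) = sine_product p0 q0}"
  define h where "h = (\<lambda>x :: real \<times> real.
    sine_product_deriv (fst x) (snd x) (fst x - pi / 6) (snd x - pi / 6)
      / ((fst x - pi / 6)\<^sup>2 + (snd x - pi / 6)\<^sup>2))"
  have K_tri: "x \<in> gap_triangle" if "x \<in> K" for x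
    using in_gap_triangle_if_sine_product_pos[of "fst x" "snd x"] sine_product_pos[OF tri] that
    by (auto simp: K_def)
  have K_ne: "x \<noteq> (pi / 6, pi / 6)" if "x \<in> K" for x
    using sine_product_less_max[OF tri ne] that by (auto simp: K_def)
  have denom: "(fst x - pi / 6)\<^sup>2 + (snd x - pi / 6)\<^sup>2 > 0" if "x \<in> K" for x
    using K_ne[OF that] by (cases x) (auto simp: sum_power2_gt_zero_iff)
  have "closed K"
    unfolding K_def sine_product_def
    by (intro closed_Collect_conj closed_Collect_le closed_Collect_eq continuous_intros)
  moreover have "bounded K"
    by (rule bounded_subset[OF bounded_cbox[of "(0, 0)" "(pi / 2, pi / 2)"]]) (auto simp: K_def cbox_Pair_eq)
  ultimately have "compact K"
    by (simp add: compact_eq_bounded_closed)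
  moreover have "continuous_on K h"
    unfolding h_def sine_product_deriv_def
    by (intro continuous_intros ballI less_imp_neq[THEN not_sym] denom)
  moreover have mem: "(p, q) \<in> K" if "(p, q) \<in> gap_triangle" "sine_product p q = sine_product p0 q0" for p q
    using that by (auto simp: K_def gap_triangle_def)
  ultimately obtain x where x: "x \<in> K" "\<And>y. y \<in> K \<Longrightarrow> h y \<le> h x"
    using continuous_attains_sup[of K h] tri by blast
  have "h x < 0"
    using sine_product_radial_deriv_neg[of "fst x" "snd x"] K_tri[OF x(1)] K_ne[OF x(1)] denom[OF x(1)]
    by (simp add: h_def divide_neg_pos)
  then show thesis
    using x(2)[OF mem] by (intro that[of "- h x"]) (auto simp: h_def)
qed

section \<open>Three vortices of equal weight\<close>

text \<open>Sine and absolute value are 1-Lipschitz, and each argument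
  \<open>2 * x $ l - 2 * x $ j\<close> moves by at most \<open>4 * norm (x - y)\<close>. Summing
  over \<open>l\<close> and \<open>j\<close> gives a global constant.\<close>

lemma vortex_velocity_lipschitz:
  fixes a :: "real ^ 'n"
  obtains L where "\<And>x y. norm (vortex_velocity a x - vortex_velocity a y) \<le> L * norm (x - y)"
proof
  fix x y :: "real ^ 'n"
  have sin_lip: "\<bar>sin s - sin t\<bar> \<le> \<bar>s - t\<bar>" for s t :: real
  proof -
    have "\<bar>sin s - sin t\<bar> = 2 * \<bar>sin ((s - t) / 2)\<bar> * \<bar>cos ((s + t) / 2)\<bar>"
      by (simp add: sin_diff_sin abs_mult)
    also have "\<dots> \<le> 2 * \<bar>(s - t) / 2\<bar> * 1"
      by (intro mult_mono abs_sin_x_le_abs_x) auto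
    finally show ?thesis by simp
  qed
  have "norm (vortex_velocity a x - vortex_velocity a y)
      \<le> (\<Sum>j\<in>UNIV. \<bar>(vortex_velocity a x - vortex_velocity a y) $ j\<bar>)"
    by (rule norm_le_l1_cart)
  also have "\<dots> \<le> (\<Sum>j\<in>(UNIV :: 'n set). 2 / pi * (\<Sum>l\<in>UNIV. \<bar>a $ l\<bar> * (4 * norm (x - y))))"
  proof (rule sum_mono)
    fix j
    have "(vortex_velocity a x - vortex_velocity a y) $ j = 2 / pi *
        (\<Sum>l\<in>UNIV. a $ l * (sin \<bar>2 * x $ l - 2 * x $ j\<bar> - sin \<bar>2 * y $ l - 2 * y $ j\<bar>))"
      by (simp only: vortex_velocity_def vector_minus_component vec_lambda_beta
          right_diff_distrib sum_subtractf)
    moreover have "\<bar>2 / pi\<bar> = 2 / pi" by simp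
    ultimately have "\<bar>(vortex_velocity a x - vortex_velocity a y) $ j\<bar> = 2 / pi *
        \<bar>\<Sum>l\<in>UNIV. a $ l * (sin \<bar>2 * x $ l - 2 * x $ j\<bar> - sin \<bar>2 * y $ l - 2 * y $ j\<bar>)\<bar>"
      by (simp only: abs_mult)
    also have "\<dots> \<le> 2 / pi * (\<Sum>l\<in>UNIV. \<bar>a $ l\<bar> * (4 * norm (x - y)))"
    proof (intro mult_left_mono order_trans[OF sum_abs] sum_mono)
      fix l
      have "\<bar>sin \<bar>2 * x $ l - 2 * x $ j\<bar> - sin \<bar>2 * y $ l - 2 * y $ j\<bar>\<bar>
          \<le> \<bar>\<bar>2 * x $ l - 2 * x $ j\<bar> - \<bar>2 * y $ l - 2 * y $ j\<bar>\<bar>"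
        by (rule sin_lip)
      also have "\<dots> \<le> \<bar>(2 * x $ l - 2 * x $ j) - (2 * y $ l - 2 * y $ j)\<bar>"
        by (rule abs_triangle_ineq3)
      also have "\<dots> \<le> 2 * \<bar>(x - y) $ l\<bar> + 2 * \<bar>(x - y) $ j\<bar>"
        by (simp add: abs_if)
      also have "\<dots> \<le> 4 * norm (x - y)"
        using component_le_norm_cart[of "x - y" l] component_le_norm_cart[of "x - y" j] by linarith
      finally show "\<bar>a $ l * (sin \<bar>2 * x $ l - 2 * x $ j\<bar> - sin \<bar>2 * y $ l - 2 * y $ j\<bar>)\<bar>
          \<le> \<bar>a $ l\<bar> * (4 * norm (x - y))"
        by (simp add: abs_mult mult_left_mono)
    qed simp
    finally show "\<bar>(vortex_velocity a x - vortex_velocity a y) $ j\<bar>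
        \<le> 2 / pi * (\<Sum>l\<in>UNIV. \<bar>a $ l\<bar> * (4 * norm (x - y)))" .
  qed
  finally show "norm (vortex_velocity a x - vortex_velocity a y)
      \<le> (\<Sum>j\<in>(UNIV :: 'n set). 2 / pi * (\<Sum>l\<in>UNIV. \<bar>a $ l\<bar> * 4)) * norm (x - y)"
    by (simp add: sum_distrib_left sum_distrib_right mult.assoc)
qed

text \<open>The system is invariant under a common shift of all positions, so a shifted and
  time-translated solution is again a solution.\<close>

lemma vortex_solution_recurrence:
  fixes \<theta> :: "real \<Rightarrow> real ^ 'n"
  assumes sol: "vortex_solution a \<theta>\<^sub>0 \<theta>" and recur: "\<theta> T = \<theta> 0 + (\<chi> j. d)"
  shows "\<theta> (t + T) = \<theta> t + (\<chi> j. d)"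
proof -
  obtain L where L: "\<And>x y. norm (vortex_velocity a x - vortex_velocity a y) \<le> L * norm (x - y)"
    using vortex_velocity_lipschitz by blast
  have shift: "vortex_velocity a (x - (\<chi> j. d)) = vortex_velocity a x" for x
    by (simp add: vortex_velocity_def algebra_simps)
  have deriv: "(\<theta> has_vector_derivative vortex_velocity a (\<theta> t)) (at t)" for t
    using sol by (simp add: vortex_solution_def)
  have "((\<lambda>t. \<theta> (t + T) - (\<chi> j. d)) has_vector_derivative vortex_velocity a (\<theta> (t + T) - (\<chi> j. d)))
      (at t)" for t
  proof -
    have "((\<lambda>t. t + T) has_vector_derivative 1) (at t)"
      by (auto intro!: derivative_eq_intros)
    from vector_diff_chain_at[OF this deriv]
    have "((\<lambda>t. \<theta> (t + T)) has_vector_derivative vortex_velocity a (\<theta> (t + T))) (at t)"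
      by (simp add: o_def)
    from has_vector_derivative_diff[OF this has_vector_derivative_const]
    show ?thesis by (simp add: shift)
  qed
  then have "\<theta> (t + T) - (\<chi> j. d) = \<theta> t"
    by (rule lipschitz_ode_unique[OF L _ deriv]) (simp add: recur)
  then show ?thesis by (simp add: diff_eq_eq)
qed

section \<open>The gap equations and their conserved quantity\<close>

lemma sin_double_diff_complementary:
  fixes p q r :: real
  assumes "p + q + r = pi / 2"
  shows "sin (2 * q) - sin (2 * r) = 2 * sin p * sin (q - r)"
proof -
  \<comment> \<open>In the sum-to-product formula the cosine factor becomes \<open>sin p\<close>,
    since \<open>q + r\<close> is complementary to \<open>p\<close>.\<close>
  have "q + r = pi / 2 - p" using assms by simp
  then have cos: "cos (q + r) = sin p" by (simp add: cos_diff)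
  have halves: "(2 * q - 2 * r) / 2 = q - r" "(2 * q + 2 * r) / 2 = q + r" by auto
  show ?thesis
    unfolding sin_diff_sin[of "2 * q" "2 * r"] halves cos by simp
qed

lemma gap_velocity:
  fixes a x :: "real ^ 3"
  assumes equal: "a $ 1 = a $ 2" "a $ 2 = a $ 3"
    and p: "p = x $ 2 - x $ 1" and q: "q = x $ 3 - x $ 2" and r: "r = pi / 2 - p - q"
    and tri: "(p, q) \<in> gap_triangle"
  shows "vortex_velocity a x $ 2 - vortex_velocity a x $ 1 = 4 / pi * a $ 1 * (sin p * sin (q - r))"
    and "vortex_velocity a x $ 3 - vortex_velocity a x $ 2 = 4 / pi * a $ 1 * (sin q * sin (r - p))"
proof -
  have pos: "0 < p" "0 < q" using tri by (auto simp: gap_triangle_def)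
  \<comment> \<open>The ordering resolves the absolute values. The outer distance is
    \<open>pi - 2 * r\<close>, whose sine is \<open>sin (2 * r)\<close>, so all three arcs enter
    symmetrically.\<close>
  have abs:
    "\<bar>2 * x $ 2 - 2 * x $ 1\<bar> = 2 * p" "\<bar>2 * x $ 1 - 2 * x $ 2\<bar> = 2 * p"
    "\<bar>2 * x $ 3 - 2 * x $ 2\<bar> = 2 * q" "\<bar>2 * x $ 2 - 2 * x $ 3\<bar> = 2 * q"
    "\<bar>2 * x $ 3 - 2 * x $ 1\<bar> = pi - 2 * r" "\<bar>2 * x $ 1 - 2 * x $ 3\<bar> = pi - 2 * r"
    using pos by (auto simp: p q r)
  have "vortex_velocity a x $ 2 - vortex_velocity a x $ 1
      = 2 / pi * a $ 1 * (sin (2 * q) - sin (2 * r))"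
    unfolding vortex_velocity_def sum_3 vec_lambda_beta abs equal[symmetric] by (simp add: algebra_simps)
  also have "sin (2 * q) - sin (2 * r) = 2 * sin p * sin (q - r)"
    by (rule sin_double_diff_complementary) (simp add: r)
  finally show "vortex_velocity a x $ 2 - vortex_velocity a x $ 1 = 4 / pi * a $ 1 * (sin p * sin (q - r))"
    by simp
  have "vortex_velocity a x $ 3 - vortex_velocity a x $ 2
      = 2 / pi * a $ 1 * (sin (2 * r) - sin (2 * p))"
    unfolding vortex_velocity_def sum_3 vec_lambda_beta abs equal[symmetric] by (simp add: algebra_simps)
  also have "sin (2 * r) - sin (2 * p) = 2 * sin q * sin (r - p)"
    by (rule sin_double_diff_complementary) (simp add: r)
  finally show "vortex_velocity a x $ 3 - vortex_velocity a x $ 2 = 4 / pi * a $ 1 * (sin q * sin (r - p))"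
    by simp
qed

text \<open>The gap velocity is tangent to the level curves of the sine product, which makes the
  latter a first integral.\<close>

lemma sine_product_deriv_gap_velocity:
  assumes "r = pi / 2 - p - q"
  shows "sine_product_deriv p q (c * (sin p * sin (q - r))) (c * (sin q * sin (r - p))) = 0"
  unfolding sine_product_deriv_def assms[symmetric] by (simp add: sin_diff algebra_simps)

text \<open>As \<open>u\<close> and \<open>v\<close> are arbitrary, this is the Hamiltonian form of
  the gap equations: \<open>p' = - c * dP/dq\<close> and \<open>q' = c * dP/dp\<close> for the sine
  product \<open>P\<close>. With \<open>(u, v)\<close> the offset from the centre, the left side is
  the angular momentum.\<close>

lemma cross_product_gap_velocity:
  assumes "r = pi / 2 - p - q"
  shows "u * (c * (sin q * sin (r - p))) - v * (c * (sin p * sin (q - r)))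
    = c * sine_product_deriv p q u v"
  unfolding sine_product_deriv_def assms[symmetric] by (simp add: sin_diff algebra_simps)

section \<open>Invariant region, equilibrium and recurrence of the gaps\<close>

locale three_equal_vortices =
  fixes a \<theta>\<^sub>0 :: "real ^ 3" and \<theta> :: "real \<Rightarrow> real ^ 3"
  assumes equal: "a $ 1 = a $ 2" "a $ 2 = a $ 3" and nonzero: "a $ 1 \<noteq> 0"
    and initial: "\<theta>\<^sub>0 \<in> initial_positions"
    and solution: "vortex_solution a \<theta>\<^sub>0 \<theta>"
begin

definition "p t = \<theta> t $ 2 - \<theta> t $ 1"
definition "q t = \<theta> t $ 3 - \<theta> t $ 2"
definition "r t = pi / 2 - p t - q t"
definition "c = 4 / pi * a $ 1"
definition "p' t = c * (sin (p t) * sin (q t - r t))"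
definition "q' t = c * (sin (q t) * sin (r t - p t))"

lemma gaps_eq: "gaps (\<theta> t) = (p t, q t)"
  by (simp add: gaps_def p_def q_def)

lemma start: "\<theta> 0 = \<theta>\<^sub>0"
  using solution by (simp add: vortex_solution_def)

lemma position_deriv:
  "((\<lambda>t. \<theta> t $ j) has_real_derivative vortex_velocity a (\<theta> t) $ j) (at t)"
  unfolding has_real_derivative_iff_has_vector_derivative
  by (rule bounded_linear.has_vector_derivative[OF bounded_linear_vec_nth])
     (use solution in \<open>simp add: vortex_solution_def\<close>)

lemma continuous_solution: "continuous_on A \<theta>"
  by (rule continuous_on_vector_derivative[of _ _ "\<lambda>t. vortex_velocity a (\<theta> t)"])
     (use solution in \<open>simp add: vortex_solution_def has_vector_derivative_at_within\<close>)

lemma continuous_gaps: "continuous_on A p" "continuous_on A q" "continuous_on A r"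
  unfolding p_def q_def r_def by (intro continuous_intros continuous_solution)+

lemma gap_derivs:
  assumes "(p t, q t) \<in> gap_triangle"
  shows "(p has_real_derivative p' t) (at t)" "(q has_real_derivative q' t) (at t)"
proof -
  note v = gap_velocity[OF equal p_def q_def r_def assms, folded c_def, folded p'_def q'_def]
  show "(p has_real_derivative p' t) (at t)" "(q has_real_derivative q' t) (at t)"
    unfolding v[symmetric] p_def q_def by (intro DERIV_diff position_deriv)+
qed

lemma sine_product_deriv_zero:
  assumes "(p t, q t) \<in> gap_triangle"
  shows "((\<lambda>t. sine_product (p t) (q t)) has_real_derivative 0) (at t)"
  using sine_product_has_derivative[OF gap_derivs[OF assms]]
  by (simp add: p'_def q'_def sine_product_deriv_gap_velocity[OF r_def])

lemma start_in_triangle: "(p 0, q 0) \<in> gap_triangle"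
  using initial by (simp add: p_def q_def start gap_triangle_def initial_positions_def)

text \<open>Both claims are proved together, as conservation is known only inside the triangle, and
  conservation is what keeps the gaps inside. The set \<open>A\<close> of times is closed by
  continuity, open because the positive product forces strict inequalities, and contains 0; the real
  line is connected.\<close>

lemma
  shows in_triangle: "(p t, q t) \<in> gap_triangle"
    and sine_product_const: "sine_product (p t) (q t) = sine_product (p 0) (q 0)"
proof -
  define A where "A = {t. 0 \<le> p t \<and> 0 \<le> q t \<and> p t + q t \<le> pi / 2 \<and>
    sine_product (p t) (q t) = sine_product (p 0) (q 0)}"
  define B where "B = {t. 0 < p t \<and> 0 < q t \<and> p t + q t < pi / 2}"
  have B: "t \<in> B \<longleftrightarrow> (p t, q t) \<in> gap_triangle" for t
    by (simp add: B_def gap_triangle_def)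
  have AB: "t \<in> B" if "t \<in> A" for t
    using that in_gap_triangle_if_sine_product_pos[of "p t" "q t"] sine_product_pos[OF start_in_triangle]
    by (simp add: A_def B)
  have "closed A"
    unfolding A_def sine_product_def
    by (intro closed_Collect_conj closed_Collect_le closed_Collect_eq continuous_intros continuous_gaps)
  moreover have "open A"
    unfolding open_contains_ball
  proof
    fix t assume t: "t \<in> A"
    have "open B"
      unfolding B_def
      by (intro open_Collect_conj open_Collect_less continuous_intros continuous_gaps)
    then obtain e where e: "e > 0" "ball t e \<subseteq> B"
      using AB[OF t] openE by blast
    \<comment> \<open>Near \<open>t\<close> the gaps stay in the triangle, so the product has zero
      derivative on a whole ball.\<close>
    have "\<exists>k. \<forall>s\<in>ball t e. sine_product (p s) (q s) = k"
      by (rule has_field_derivative_zero_constant)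
         (use e B sine_product_deriv_zero has_field_derivative_at_within in blast)+
    then have "sine_product (p s) (q s) = sine_product (p t) (q t)" if "s \<in> ball t e" for s
      using that e(1) by (metis centre_in_ball)
    then have "ball t e \<subseteq> A"
      using e(2) t by (fastforce simp: A_def B_def)
    with e(1) show "\<exists>e>0. ball t e \<subseteq> A"
      by blast
  qed
  moreover have "0 \<in> A"
    using start_in_triangle by (simp add: A_def gap_triangle_def)
  ultimately have "t \<in> A"
    using clopen[of A] by auto
  then show "(p t, q t) \<in> gap_triangle" "sine_product (p t) (q t) = sine_product (p 0) (q 0)"
    using AB B by (auto simp: A_def)
qed

text \<open>The centre is the strict maximum of the conserved product, so no other point of the
  triangle shares its level.\<close>

lemma equilibrium:
  assumes "(p 0, q 0) = (pi / 6, pi / 6)"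
  shows "(p t, q t) = (pi / 6, pi / 6)"
proof (rule ccontr)
  assume "(p t, q t) \<noteq> (pi / 6, pi / 6)"
  from sine_product_less_max[OF in_triangle this] show False
    using assms sine_product_const[of t] by (metis prod.inject less_irrefl)
qed

lemma stationary_imp_equilibrium:
  assumes "\<And>t. (p t, q t) = (p 0, q 0)"
  shows "(p 0, q 0) = (pi / 6, pi / 6)"
proof -
  have "p t = p 0" "q t = q 0" for t using assms[of t] by simp_all
  then have const: "p = (\<lambda>_. p 0)" "q = (\<lambda>_. q 0)" by blast+
  have "(p has_real_derivative 0) (at 0)" "(q has_real_derivative 0) (at 0)"
    by (subst const, rule DERIV_const)+
  then have "p' 0 = 0" "q' 0 = 0"
    using gap_derivs[OF in_triangle] DERIV_unique by blast+
  \<comment> \<open>Vanishing velocity gives vanishing angular momentum, which is \<open>c\<close>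
    times the radial derivative and hence nonzero off the centre.\<close>
  then have "c * sine_product_deriv (p 0) (q 0) (p 0 - pi / 6) (q 0 - pi / 6) = 0"
    unfolding cross_product_gap_velocity[OF r_def, symmetric] p'_def q'_def
    by (simp only: mult_zero_right diff_self)
  then show ?thesis
    using sine_product_radial_deriv_neg[OF in_triangle] nonzero by (fastforce simp: c_def)
qed

lemma gaps_recur: "\<exists>T>0. (p T, q T) = (p 0, q 0)"
proof (cases "(p 0, q 0) = (pi / 6, pi / 6)")
  case True
  then show ?thesis using equilibrium[of 1] by (intro exI[of _ 1]) auto
next
  case False
  \<comment> \<open>The offset of the gaps from the centre, as a plane curve to which the full-turn
    lemma applies.\<close>
  define w where "w t = Complex (p t - pi / 6) (q t - pi / 6)" for t
  define w' where "w' t = Complex (p' t) (q' t)" for t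
  obtain \<delta> where "\<delta> > 0" and \<delta>: "\<And>t. sine_product_deriv (p t) (q t) (p t - pi / 6) (q t - pi / 6)
      / ((p t - pi / 6)\<^sup>2 + (q t - pi / 6)\<^sup>2) \<le> - \<delta>"
    using angular_velocity_bound[OF start_in_triangle False] in_triangle sine_product_const by metis
  have "c \<noteq> 0" using nonzero by (simp add: c_def)
  \<comment> \<open>The radial derivative is negative, so the gaps turn in the direction opposite to
    the sign of \<open>c\<close>.\<close>
  define \<sigma> where "\<sigma> = - sgn c"
  have w_deriv: "(w has_vector_derivative w' t) (at t)" for t
    unfolding w_def[abs_def] w'_def has_vector_derivative_complex_iff
    using gap_derivs[OF in_triangle[of t]] by (auto intro!: derivative_eq_intros)
  have w'_cont: "continuous_on UNIV w'"
    unfolding w'_def[abs_def] p'_def q'_def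
    by (intro continuous_on_Complex continuous_intros continuous_gaps)
  have w_nz: "w t \<noteq> 0" for t
  proof
    assume "w t = 0"
    then have "p t = pi / 6" "q t = pi / 6" by (auto simp: w_def complex_eq_iff)
    then show False
      using sine_product_less_max[OF start_in_triangle False] sine_product_const[of t]
      by (simp only: less_irrefl)
  qed
  have turn: "\<bar>c\<bar> * \<delta> \<le> \<sigma> * Im (w' t / w t)" for t
  proof -
    \<comment> \<open>The angular velocity is the cross product of offset and velocity divided by
      the squared distance.\<close>
    have "Im (w' t / w t) = c * (sine_product_deriv (p t) (q t) (p t - pi / 6) (q t - pi / 6)
        / ((p t - pi / 6)\<^sup>2 + (q t - pi / 6)\<^sup>2))"
      using cross_product_gap_velocity[OF r_def, of "p t - pi / 6" c t "q t - pi / 6"]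
      by (simp add: Im_divide w_def w'_def p'_def q'_def mult.commute)
    then have "\<sigma> * Im (w' t / w t) = \<bar>c\<bar> * - (sine_product_deriv (p t) (q t) (p t - pi / 6) (q t - pi / 6)
        / ((p t - pi / 6)\<^sup>2 + (q t - pi / 6)\<^sup>2))"
      by (simp add: \<sigma>_def abs_sgn mult_ac)
    also have "\<dots> \<ge> \<bar>c\<bar> * \<delta>"
      using \<delta>[of t] by (intro mult_left_mono) auto
    finally show ?thesis .
  qed
  obtain T k where T: "T > 0" "k > 0" "w T = of_real k * w 0"
    by (rule curve_full_turn[OF w_deriv w'_cont w_nz _ _ turn])
       (use \<open>c \<noteq> 0\<close> \<open>\<delta> > 0\<close> in \<open>auto simp: \<sigma>_def sgn_if\<close>)
  then have pq: "p T = pi / 6 + k * (p 0 - pi / 6)" "q T = pi / 6 + k * (q 0 - pi / 6)"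
    by (auto simp: w_def complex_eq_iff)
  have "k = 1"
    by (rule sine_product_level_meets_ray_once[of k "p 0 - pi / 6" "q 0 - pi / 6"])
       (use T(2) False in_triangle[of T] start_in_triangle sine_product_const[of T] in \<open>auto simp: pq\<close>)
  then show ?thesis using T(1) pq by auto
qed

section \<open>Periodicity of the gaps and quasi-periodicity on the circle\<close>

lemma solution_recurs: "\<exists>T>0. \<exists>d. \<forall>t. \<theta> (t + T) = \<theta> t + (\<chi> j. d)"
proof -
  obtain T where T: "T > 0" "p T = p 0" "q T = q 0"
    using gaps_recur by auto
  \<comment> \<open>Configurations with equal gaps differ by a common shift, read off from the first
    vortex.\<close>
  have "\<theta> T = \<theta> 0 + (\<chi> j. \<theta> T $ 1 - \<theta> 0 $ 1)"
    using T(2,3) by (simp add: p_def q_def vec_eq_iff forall_3)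
  then have "\<theta> (t + T) = \<theta> t + (\<chi> j. \<theta> T $ 1 - \<theta> 0 $ 1)" for t
    by (rule vortex_solution_recurrence[OF solution])
  with T(1) show ?thesis by blast
qed

lemma gaps_periodic: "\<exists>T>0. periodic_fun_simple (\<lambda>t. gaps (\<theta> t)) T"
proof -
  obtain T d where T: "T > 0" "\<And>t. \<theta> (t + T) = \<theta> t + (\<chi> j. d)"
    using solution_recurs by blast
  then have "periodic_fun_simple (\<lambda>t. gaps (\<theta> t)) T"
    by unfold_locales (simp add: gaps_def)
  with T(1) show ?thesis by blast
qed

lemma stationary_iff: "(\<forall>t. gaps (\<theta> t) = gaps \<theta>\<^sub>0) \<longleftrightarrow> gaps \<theta>\<^sub>0 = (pi / 6, pi / 6)"
  unfolding start[symmetric] gaps_eq using equilibrium stationary_imp_equilibrium by metis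

lemma circle_positions_quasi_periodic: "quasi_periodic (\<lambda>t. circle_positions (\<theta> t))"
proof -
  obtain T d where T: "T > 0" "\<And>t. \<theta> (t + T) = \<theta> t + (\<chi> j. d)"
    using solution_recurs by blast
  \<comment> \<open>The factor 4 in the embedding of the circle turns a shift by \<open>d\<close>
    into a rotation by \<open>4 * d\<close>.\<close>
  have "circle_positions (\<theta> (t + T)) $ j = cis (4 * d) * circle_positions (\<theta> t) $ j" for t j
    by (simp add: circle_positions_def T(2) cis_mult distrib_left add.commute[of "4 * d"])
  moreover have "continuous_on UNIV (\<lambda>t. circle_positions (\<theta> t))"
    unfolding circle_positions_def by (intro continuous_intros continuous_solution)
  ultimately show ?thesis
    using quasi_periodic_if_periodic_up_to_rotation T(1) by blast
qed

end

theorem theorem5: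
  fixes a :: "real ^ 3"
  assumes "a $ 1 = a $ 2" and "a $ 2 = a $ 3" and "a $ 1 \<noteq> 0"
  shows "(\<forall>\<theta>\<^sub>0\<in>initial_positions. \<forall>\<theta>. vortex_solution a \<theta>\<^sub>0 \<theta> \<longrightarrow>
            (\<exists>T>0. periodic_fun_simple (\<lambda>t. gaps (\<theta> t)) T) \<and>
            ((\<forall>t. gaps (\<theta> t) = gaps \<theta>\<^sub>0) \<longleftrightarrow> gaps \<theta>\<^sub>0 = (pi / 6, pi / 6))) \<and>
         generically initial_positions
           (\<lambda>\<theta>\<^sub>0. \<forall>\<theta>. vortex_solution a \<theta>\<^sub>0 \<theta> \<longrightarrow>
              quasi_periodic (\<lambda>t. circle_positions (\<theta> t)))"
proof -
  have vortices: "three_equal_vortices a \<theta>\<^sub>0 \<theta>"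
    if "\<theta>\<^sub>0 \<in> initial_positions" "vortex_solution a \<theta>\<^sub>0 \<theta>" for \<theta>\<^sub>0 \<theta>
    using that assms by (simp add: three_equal_vortices_def)
  \<comment> \<open>Quasi-periodicity holds from every admissible start, so the whole set serves as
    the open, dense set of full measure.\<close>
  have "generically initial_positions
      (\<lambda>\<theta>\<^sub>0. \<forall>\<theta>. vortex_solution a \<theta>\<^sub>0 \<theta> \<longrightarrow> quasi_periodic (\<lambda>t. circle_positions (\<theta> t)))"
    unfolding generically_def
    using three_equal_vortices.circle_positions_quasi_periodic[OF vortices]
    by (intro exI[of _ initial_positions]) (auto intro: closure_subset[THEN subsetD])
  then show ?thesis
    using three_equal_vortices.gaps_periodic[OF vortices]
      three_equal_vortices.stationary_iff[OF vortices] by blast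
qed

end
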